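(* Let $G$ be a finite group of order $n$ with identity $e$. Then $\lambda(\mathcal{P}_E(G))\geq n$, and equality $\lambda(\mathcal{P}_E(G))=n$ holds if and only if the graph $\overline{\mathcal{P}_E(G)\setminus\{e\}}$ contains a Hamiltonian path.
   Context: The enhanced power graph $\mathcal{P}_E(G)$ of a finite group $G$ is the simple undirected graph with vertex set $G$ in which two distinct vertices $x,y$ are adjacent if there is $z\in G$ with $x,y\in\langle z\rangle$. $\mathcal{P}_E(G)\setminus\{e\}$ is the subgraph of $\mathcal{P}_E(G)$ induced by $G\setminus\{e\}$, and $\overline{\Gamma}$ denotes the complement of a graph $\Gamma$ (same vertex set, two distinct vertices being adjacent exactly when they are not adjacent in $\Gamma$). An $L(2,1)$-labeling of a graph $\Gamma$ is an integer-valued function $f$ on $V(\Gamma)$ such that $|f(u)-f(v)|\geq 2$ whenever $u,v$ are adjacent and $|f(u)-f(v)|\geq 1$ whenever $u,v$ are at distance $2$. Its span is the difference between the maximum and the minimum of $f$. The $\lambda$-number $\lambda(\Gamma)$ is the minimum span over all $L(2,1)$-labelings of $\Gamma$. A Hamiltonian path is a path containing every vertex of the graph exactly once.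
   Formalization: The formal theorem assumes that G has order n at least 2; for the trivial group the claimed inequality fails, since the enhanced power graph is then a single vertex with λ-number 0 < 1 = n. *)

theory Defs
  imports "HOL-Algebra.Generated_Groups" "Graph_Theory.Graph_Theory"
begin

text \<open>
  Simple undirected graphs are symmetric loop-free digraphs without parallel arcs,
  i.e. instances of the locale \<^locale>\<open>graph\<close>.
\<close>

definition enhanced_power_graph :: "('a, 'm) monoid_scheme \<Rightarrow> ('a, 'a \<times> 'a) pre_digraph" where
  "enhanced_power_graph G = with_proj
     \<lparr> pverts = carrier G,
       parcs = {(x, y). x \<in> carrier G \<and> y \<in> carrier G \<and> x \<noteq> y \<and>
                        (\<exists>z \<in> carrier G. x \<in> generate G {z} \<and> y \<in> generate G {z})} \<rparr>"

definition graph_complement :: "('a, 'b) pre_digraph \<Rightarrow> ('a, 'a \<times> 'a) pre_digraph" where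
  "graph_complement \<Gamma> = with_proj
     \<lparr> pverts = verts \<Gamma>,
       parcs = {(u, v). u \<in> verts \<Gamma> \<and> v \<in> verts \<Gamma> \<and> u \<noteq> v \<and> \<not> u \<rightarrow>\<^bsub>\<Gamma>\<^esub> v} \<rparr>"

definition hamiltonian_path :: "('a, 'b) pre_digraph \<Rightarrow> 'a list \<Rightarrow> bool" where
  "hamiltonian_path \<Gamma> p \<longleftrightarrow> vpath p \<Gamma> \<and> set p = verts \<Gamma>"

text \<open>
  With every arc weighted 1, the shortest-path cost is the usual graph distance
  (infinite between different components).
\<close>

definition graph_dist :: "('a, 'b) pre_digraph \<Rightarrow> 'a \<Rightarrow> 'a \<Rightarrow> ereal" where
  "graph_dist \<Gamma> u v = wf_digraph.\<mu> \<Gamma> (\<lambda>_. 1) u v"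

text \<open>Only the values of a labeling on the vertex set are relevant.\<close>

definition L21_labeling :: "('a, 'b) pre_digraph \<Rightarrow> ('a \<Rightarrow> int) \<Rightarrow> bool" where
  "L21_labeling \<Gamma> f \<longleftrightarrow>
     (\<forall>u \<in> verts \<Gamma>. \<forall>v \<in> verts \<Gamma>.
        (u \<rightarrow>\<^bsub>\<Gamma>\<^esub> v \<longrightarrow> \<bar>f u - f v\<bar> \<ge> 2) \<and>
        (graph_dist \<Gamma> u v = 2 \<longrightarrow> \<bar>f u - f v\<bar> \<ge> 1))"

definition labeling_span :: "('a, 'b) pre_digraph \<Rightarrow> ('a \<Rightarrow> int) \<Rightarrow> int" where
  "labeling_span \<Gamma> f = Max (f ` verts \<Gamma>) - Min (f ` verts \<Gamma>)"

text \<open>Meant for finite nonempty graphs, where spans are natural numbers and labelings exist.\<close>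

definition lambda_number :: "('a, 'b) pre_digraph \<Rightarrow> nat" where
  "lambda_number \<Gamma> = (LEAST k. \<exists>f. L21_labeling \<Gamma> f \<and> labeling_span \<Gamma> f = int k)"

lemma graph_enhanced_power_graph:
  assumes "finite (carrier G)"
  shows "graph (enhanced_power_graph G)"
proof -
  have "finite {(x, y). x \<in> carrier G \<and> y \<in> carrier G \<and> x \<noteq> y \<and>
                 (\<exists>z \<in> carrier G. x \<in> generate G {z} \<and> y \<in> generate G {z})}"
    by (rule finite_subset[of _ "carrier G \<times> carrier G"]) (use assms in auto)
  with assms show ?thesis
    unfolding enhanced_power_graph_def
    by unfold_locales (auto simp: arc_to_ends_def symmetric_def sym_def)
qed

end

theory Submission
  imports Defs
begin

text \<open>
  The only property of the enhanced power graph that matters is that the identity is adjacent to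
  every other vertex. So let \<open>\<Gamma>\<close> be a finite graph with \<open>n \<ge> 2\<close> vertices and a dominating vertex
  \<open>w\<close>. Any two distinct nonadjacent vertices have distance 2 (through \<open>w\<close>), hence an
  \<open>L(2,1)\<close>-labeling of \<open>\<Gamma>\<close> is an injective labeling in which adjacent vertices get nonconsecutive
  labels (\<open>L21_labeling_iff_inj_on\<close>). It uses \<open>n\<close> values, and \<open>f w - 1\<close> and \<open>f w + 1\<close> are not
  among them. At least one of these two lies between the extreme labels, so the span is at least
  \<open>n\<close>. If the span is \<open>n\<close>, then exactly one integer between the extreme labels is unused, so \<open>f w\<close>
  is itself extreme and the other vertices fill an interval of \<open>n - 1\<close> integers
  (\<open>image_eq_interval_of_span_eq_card\<close>). Listed by increasing label, they form a Hamiltonian path in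
  the complement of \<open>\<Gamma> - w\<close>, because consecutive labels force nonadjacency. Conversely, numbering
  the vertices along such a path by \<open>0, \<dots>, n - 2\<close> and giving \<open>w\<close> the label \<open>n\<close> yields a labeling of
  span \<open>n\<close>.
\<close>

section \<open>Distances and labelings\<close>

lemma (in wf_digraph) graph_dist_self_le_0:
  assumes "u \<in> verts G"
  shows "graph_dist G u u \<le> 0"
  using min_cost_le_walk_cost[of u "[]" u "\<lambda>_. 1"] assms
  by (simp add: graph_dist_def awalk_def zero_ereal_def)

lemma (in wf_digraph) graph_dist_eq_2:
  assumes "u \<noteq> v" and "\<not> u \<rightarrow>\<^bsub>G\<^esub> v" and "u \<rightarrow>\<^bsub>G\<^esub> w" and "w \<rightarrow>\<^bsub>G\<^esub> v"
  shows "graph_dist G u v = 2"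
proof (rule antisym)
  obtain d e where "d \<in> arcs G" "tail G d = u" "head G d = w"
    "e \<in> arcs G" "tail G e = w" "head G e = v"
    using assms(3,4) by (auto simp: arcs_ends_conv)
  then have "awalk u [d, e] v"
    by (auto simp: awalk_def)
  then show "graph_dist G u v \<le> 2"
    using min_cost_le_walk_cost[of u "[d, e]" v "\<lambda>_. 1"]
    by (simp add: graph_dist_def awalk_cost_def)
next
  have "2 \<le> ereal (awalk_cost (\<lambda>_. 1) p)" if "awalk u p v" for p
  proof -
    have "length p \<noteq> 0"
      using that assms(1) by (auto simp: awalk_def)
    moreover have "length p \<noteq> 1"
      using that assms(2) by (auto simp: awalk_def length_Suc_conv arcs_ends_conv)
    ultimately have "2 \<le> length p" by linarith
    then show ?thesis
      by (simp add: awalk_cost_def sum_list_triv)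
  qed
  then show "2 \<le> graph_dist G u v"
    unfolding graph_dist_def \<mu>_def by (intro INF_greatest) auto
qed

text \<open>
  With a dominating vertex \<open>w\<close> all distances are at most 2, so the two conditions of an
  \<open>L(2,1)\<close>-labeling together constrain every pair of distinct vertices.
\<close>

lemma (in sym_digraph) L21_labeling_iff_inj_on:
  assumes dom: "\<And>v. v \<in> verts G \<Longrightarrow> v \<noteq> w \<Longrightarrow> w \<rightarrow>\<^bsub>G\<^esub> v"
  shows "L21_labeling G f \<longleftrightarrow>
    inj_on f (verts G) \<and> (\<forall>u v. u \<rightarrow>\<^bsub>G\<^esub> v \<longrightarrow> \<bar>f u - f v\<bar> \<ge> 2)"
    (is "?L \<longleftrightarrow> ?R")
proof
  assume L: ?L
  have adj: "\<bar>f u - f v\<bar> \<ge> 2" if "u \<rightarrow>\<^bsub>G\<^esub> v" for u v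
    using L that adj_in_verts[OF that] by (auto simp: L21_labeling_def)
  have "f u \<noteq> f v" if "u \<in> verts G" "v \<in> verts G" "u \<noteq> v" for u v
  proof (cases "u \<rightarrow>\<^bsub>G\<^esub> v")
    case True
    then show ?thesis using adj[OF True] by auto
  next
    case False
    then have nsym: "\<not> v \<rightarrow>\<^bsub>G\<^esub> u"
      using arcs_ends_symmetric[OF sym_arcs] by blast
    then have "u \<noteq> w" "v \<noteq> w"
      using dom that False by auto
    then have "u \<rightarrow>\<^bsub>G\<^esub> w" "w \<rightarrow>\<^bsub>G\<^esub> v"
      using dom that arcs_ends_symmetric[OF sym_arcs] by blast+
    then have "graph_dist G u v = 2"
      using graph_dist_eq_2 that(3) False by blast
    then show ?thesis
      using L that by (force simp: L21_labeling_def)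
  qed
  then show ?R
    using adj by (auto simp: inj_on_def)
next
  assume R: ?R
  have "\<bar>f u - f v\<bar> \<ge> 1" if "u \<in> verts G" "v \<in> verts G" "graph_dist G u v = 2" for u v
  proof -
    have "u \<noteq> v"
      using graph_dist_self_le_0[OF that(1)] that(3) by auto
    then have "f u \<noteq> f v"
      using R that by (auto simp: inj_on_def)
    then show ?thesis by linarith
  qed
  then show ?L
    using R by (auto simp: L21_labeling_def)
qed

lemma labeling_span_nonneg:
  assumes "finite (verts \<Gamma>)" and "verts \<Gamma> \<noteq> {}"
  shows "labeling_span \<Gamma> f \<ge> 0"
proof -
  have "Min (f ` verts \<Gamma>) \<le> Max (f ` verts \<Gamma>)"
    using assms by (meson Max_ge Min_in finite_imageI image_is_empty)
  then show ?thesis by (simp add: labeling_span_def)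
qed

lemma lambda_number_le:
  assumes "L21_labeling \<Gamma> f" and "labeling_span \<Gamma> f = int k"
  shows "lambda_number \<Gamma> \<le> k"
  unfolding lambda_number_def using assms by (blast intro: Least_le)

text \<open>Some labeling exists, so the minimum that defines the \<open>\<lambda>\<close>-number is attained.\<close>

lemma (in digraph) lambda_number_attained:
  assumes "verts G \<noteq> {}"
  obtains f where "L21_labeling G f" and "labeling_span G f = int (lambda_number G)"
proof -
  obtain h :: "'a \<Rightarrow> nat" where h: "inj_on h (verts G)"
    using finite_imp_inj_to_nat_seg[OF finite_verts] by blast
  \<comment> \<open>Even labels: any two distinct vertices get labels at least 2 apart, adjacent or not.\<close>
  define f where "f v = 2 * int (h v)" for v
  have "\<bar>f u - f v\<bar> \<ge> 2" if "u \<in> verts G" "v \<in> verts G" "u \<noteq> v" for u v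
  proof -
    have "h u \<noteq> h v"
      using h that by (auto simp: inj_on_def)
    then show ?thesis unfolding f_def by linarith
  qed
  moreover have "u \<noteq> v" if "u \<in> verts G" "graph_dist G u v = 2" for u v
    using graph_dist_self_le_0[OF that(1)] that(2) by auto
  moreover have "u \<noteq> v" if "u \<rightarrow>\<^bsub>G\<^esub> v" for u v
    using adj_not_same that by auto
  ultimately have "L21_labeling G f"
    unfolding L21_labeling_def by (meson order_trans one_le_numeral)
  moreover have "labeling_span G f = int (nat (labeling_span G f))"
    using labeling_span_nonneg[OF finite_verts assms] by simp
  ultimately have "\<exists>k f. L21_labeling G f \<and> labeling_span G f = int k"
    by blast
  then have "\<exists>f. L21_labeling G f \<and> labeling_span G f = int (lambda_number G)"
    unfolding lambda_number_def by (rule LeastI_ex)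
  then show thesis using that by blast
qed

section \<open>Finite sets of integers with a gap around one element\<close>

text \<open>
  The combinatorial core, to be applied to the set \<open>A\<close> of labels and the label \<open>c\<close> of the
  dominating vertex: an unused neighbour of \<open>c\<close> between the extremes costs one extra integer, and
  minimal span allows only one such gap.
\<close>

lemma card_le_span_of_gap:
  fixes A :: "int set"
  assumes fin: "finite A" and two: "card A \<ge> 2" and c: "c \<in> A" "c - 1 \<notin> A" "c + 1 \<notin> A"
  shows "int (card A) \<le> Max A - Min A"
    and "Max A - Min A = int (card A) \<Longrightarrow> \<exists>a. A - {c} = {a..<a + int (card A) - 1}"
proof -
  let ?m = "Min A" and ?M = "Max A"
  have sub: "A \<subseteq> {?m..?M}" using fin by auto
  have ne: "A \<noteq> {}" using c by auto
  have "?m \<in> A" "?M \<in> A" using fin ne by auto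
  have m: "?m \<le> c" "?m \<noteq> c - 1" and M: "c \<le> ?M" "?M \<noteq> c + 1"
    using fin c \<open>?m \<in> A\<close> \<open>?M \<in> A\<close> by auto
  have lt: "?m < ?M"
  proof (rule ccontr)
    assume "\<not> ?m < ?M"
    then have "A \<subseteq> {c}" using m M sub by force
    then have "card A \<le> card {c}" by (intro card_mono) auto
    then show False using two by simp
  qed
  have card_sub: "int (card B) \<le> ?M - ?m + 1" if "B \<subseteq> {?m..?M}" for B
  proof -
    have "card B \<le> card {?m..?M}" using that by (intro card_mono) auto
    then show ?thesis using lt by simp
  qed
  have low: "int (card A) \<le> ?M - ?m" if "x \<in> {?m..?M}" "x \<notin> A" for x
    using card_sub[of "insert x A"] that sub fin by simp
  have "c - 1 \<in> {?m..?M} \<or> c + 1 \<in> {?m..?M}"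
    using m M lt by auto
  then show "int (card A) \<le> ?M - ?m"
    using low c(2,3) by blast
  show "\<exists>a. A - {c} = {a..<a + int (card A) - 1}" if eq: "?M - ?m = int (card A)"
  proof -
    have fill: "insert x A = {?m..?M}" if "x \<in> {?m..?M}" "x \<notin> A" for x
    proof (rule card_subset_eq)
      show "card (insert x A) = card {?m..?M}"
        using that fin eq by simp
    qed (use that sub in auto)
    \<comment> \<open>If \<open>c\<close> were strictly inside, both its neighbours would be unused.\<close>
    consider "c = ?m" | "c = ?M"
    proof -
      have "c - 1 \<notin> {?m..?M} \<or> c + 1 \<notin> {?m..?M}"
      proof (rule ccontr)
        assume "\<not> ?thesis"
        then have "c + 1 \<in> insert (c - 1) A"
          using fill[of "c - 1"] c(2) by blast
        then show False using c(3) by simp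
      qed
      then show thesis using that m M by fastforce
    qed
    then show ?thesis
    proof cases
      case 1
      then have "insert (c + 1) A = {?m..?M}"
        using fill c m M lt by auto
      then have "A - {c} = {?m..?M} - {c, c + 1}" using c by auto
      also have "\<dots> = {c + 2..<c + 2 + int (card A) - 1}"
        using 1 eq by auto
      finally show ?thesis by blast
    next
      case 2
      then have "insert (c - 1) A = {?m..?M}"
        using fill c m M lt by auto
      then have "A - {c} = {?m..?M} - {c, c - 1}" using c by auto
      also have "\<dots> = {?m..<?m + int (card A) - 1}"
        using 2 eq by auto
      finally show ?thesis by blast
    qed
  qed
qed

section \<open>Hamiltonian paths in complements\<close>

lemma set_vwalk_arcs_conv:
  "set (vwalk_arcs p) = {(p ! i, p ! Suc i) | i. Suc i < length p}"
proof (induction p rule: vwalk_arcs.induct)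
  case (3 x y xs)
  have "{(((x # y # xs) ! i), (x # y # xs) ! Suc i) | i. Suc i < length (x # y # xs)} =
    insert (x, y) {((y # xs) ! i, (y # xs) ! Suc i) | i. Suc i < length (y # xs)}"
    (is "?A = insert _ ?B")
  proof (intro equalityI subsetI)
    fix a assume "a \<in> ?A"
    then obtain i where "a = ((x # y # xs) ! i, (x # y # xs) ! Suc i)" "Suc i < length (x # y # xs)"
      by blast
    then show "a \<in> insert (x, y) ?B"
      by (cases i) auto
  next
    fix a assume "a \<in> insert (x, y) ?B"
    then consider "a = (x, y)"
      | i where "a = ((y # xs) ! i, (y # xs) ! Suc i)" "Suc i < length (y # xs)"
      by blast
    then show "a \<in> ?A"
    proof cases
      case 1
      then show ?thesis by (auto intro!: exI[of _ 0])
    next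
      case 2
      then show ?thesis by (auto intro!: exI[of _ "Suc i"])
    qed
  qed
  then show ?case using 3 by simp
qed auto

lemma arcs_ends_graph_complement:
  "u \<rightarrow>\<^bsub>graph_complement \<Gamma>\<^esub> v \<longleftrightarrow>
     u \<in> verts \<Gamma> \<and> v \<in> verts \<Gamma> \<and> u \<noteq> v \<and> \<not> u \<rightarrow>\<^bsub>\<Gamma>\<^esub> v"
  by (auto simp: graph_complement_def arcs_ends_conv)

lemma arcs_ends_induce_subgraph:
  "u \<rightarrow>\<^bsub>\<Gamma> \<restriction> S\<^esub> v \<longleftrightarrow> u \<in> S \<and> v \<in> S \<and> u \<rightarrow>\<^bsub>\<Gamma>\<^esub> v"
  by (auto simp: arcs_ends_conv)

lemma hamiltonian_path_complement_induce_iff: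
  "hamiltonian_path (graph_complement (\<Gamma> \<restriction> S)) p \<longleftrightarrow>
     p \<noteq> [] \<and> distinct p \<and> set p = S \<and> (\<forall>i. Suc i < length p \<longrightarrow> \<not> p ! i \<rightarrow>\<^bsub>\<Gamma>\<^esub> p ! Suc i)"
proof -
  have "verts (graph_complement (\<Gamma> \<restriction> S)) = S"
    by (simp add: graph_complement_def)
  then have "hamiltonian_path (graph_complement (\<Gamma> \<restriction> S)) p \<longleftrightarrow>
      p \<noteq> [] \<and> distinct p \<and> set p = S \<and>
      (\<forall>i. Suc i < length p \<longrightarrow> p ! i \<rightarrow>\<^bsub>graph_complement (\<Gamma> \<restriction> S)\<^esub> p ! Suc i)"
    by (auto simp: hamiltonian_path_def vpath_def vwalk_def set_vwalk_arcs_conv)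
  also have "\<dots> \<longleftrightarrow> p \<noteq> [] \<and> distinct p \<and> set p = S \<and>
      (\<forall>i. Suc i < length p \<longrightarrow> \<not> p ! i \<rightarrow>\<^bsub>\<Gamma>\<^esub> p ! Suc i)"
    by (auto simp: arcs_ends_graph_complement arcs_ends_induce_subgraph nth_eq_iff_index_eq)
  finally show ?thesis .
qed

section \<open>Graphs with a dominating vertex\<close>

context graph
begin

lemma L21_labeling_gap_at_dominating_vertex:
  assumes w: "w \<in> verts G" and dom: "\<And>v. v \<in> verts G \<Longrightarrow> v \<noteq> w \<Longrightarrow> w \<rightarrow>\<^bsub>G\<^esub> v"
    and f: "L21_labeling G f"
  shows "f w - 1 \<notin> f ` verts G" and "f w + 1 \<notin> f ` verts G"
proof -
  have far: "\<bar>f w - f v\<bar> \<ge> 2" if "v \<in> verts G" "v \<noteq> w" for v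
    using f w dom[OF that] that by (auto simp: L21_labeling_def)
  have "f v \<noteq> f w - 1 \<and> f v \<noteq> f w + 1" if "v \<in> verts G" for v
    using far[OF that] by (cases "v = w") auto
  then show "f w - 1 \<notin> f ` verts G" "f w + 1 \<notin> f ` verts G"
    by force+
qed

lemma card_le_labeling_span:
  assumes w: "w \<in> verts G" and dom: "\<And>v. v \<in> verts G \<Longrightarrow> v \<noteq> w \<Longrightarrow> w \<rightarrow>\<^bsub>G\<^esub> v"
    and two: "card (verts G) \<ge> 2" and f: "L21_labeling G f"
  shows "int (card (verts G)) \<le> labeling_span G f"
proof -
  have "card (f ` verts G) = card (verts G)"
    using f L21_labeling_iff_inj_on[OF dom] by (simp add: card_image)
  then show ?thesis
    using card_le_span_of_gap(1)[of "f ` verts G" "f w"] two w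
      L21_labeling_gap_at_dominating_vertex[OF w dom f]
    by (simp add: labeling_span_def)
qed

lemma image_eq_interval_of_span_eq_card:
  assumes w: "w \<in> verts G" and dom: "\<And>v. v \<in> verts G \<Longrightarrow> v \<noteq> w \<Longrightarrow> w \<rightarrow>\<^bsub>G\<^esub> v"
    and two: "card (verts G) \<ge> 2" and f: "L21_labeling G f"
    and span: "labeling_span G f = int (card (verts G))"
  obtains a where "f ` (verts G - {w}) = {a..<a + int (card (verts G)) - 1}"
proof -
  have inj: "inj_on f (verts G)"
    using f L21_labeling_iff_inj_on[OF dom] by simp
  then have "card (f ` verts G) = card (verts G)"
    by (simp add: card_image)
  then have "\<exists>a. f ` verts G - {f w} = {a..<a + int (card (verts G)) - 1}"
    using card_le_span_of_gap(2)[of "f ` verts G" "f w"] two w span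
      L21_labeling_gap_at_dominating_vertex[OF w dom f]
    by (simp add: labeling_span_def)
  moreover have "f ` verts G - {f w} = f ` (verts G - {w})"
    using inj w by (auto simp: inj_on_def)
  ultimately show thesis using that by auto
qed

lemma hamiltonian_path_of_labeling:
  assumes w: "w \<in> verts G" and dom: "\<And>v. v \<in> verts G \<Longrightarrow> v \<noteq> w \<Longrightarrow> w \<rightarrow>\<^bsub>G\<^esub> v"
    and two: "card (verts G) \<ge> 2" and f: "L21_labeling G f"
    and span: "labeling_span G f = int (card (verts G))"
  shows "\<exists>p. hamiltonian_path (graph_complement (G \<restriction> (verts G - {w}))) p"
proof -
  let ?S = "verts G - {w}" and ?k = "card (verts G) - 1"
  obtain a where "f ` ?S = {a..<a + int (card (verts G)) - 1}"
    using image_eq_interval_of_span_eq_card[OF w dom two f span] by blast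
  then have img: "f ` ?S = {a..<a + int ?k}"
    using two by (simp add: algebra_simps)
  have inj: "inj_on f (verts G)" and adj: "\<And>u v. u \<rightarrow>\<^bsub>G\<^esub> v \<Longrightarrow> \<bar>f u - f v\<bar> \<ge> 2"
    using f L21_labeling_iff_inj_on[OF dom] by auto
  \<comment> \<open>\<open>g i\<close> is the vertex other than \<open>w\<close> with the label \<open>a + i\<close>.\<close>
  define g where "g i = inv_into ?S f (a + int i)" for i
  have g: "g i \<in> ?S" "f (g i) = a + int i" if "i < ?k" for i
  proof -
    have "a + int i \<in> f ` ?S" using that img by auto
    then show "g i \<in> ?S" "f (g i) = a + int i"
      unfolding g_def by (auto simp only: inv_into_into f_inv_into_f)
  qed
  have onto: "v \<in> g ` {..<?k}" if "v \<in> ?S" for v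
  proof -
    have "f v \<in> {a..<a + int ?k}" using that img by blast
    then have i: "nat (f v - a) < ?k" "a + int (nat (f v - a)) = f v" by auto
    have "g (nat (f v - a)) = v"
      using g[OF i(1)] i(2) that inj by (auto simp: inj_on_def)
    then show ?thesis using i(1) by (metis imageI lessThan_iff)
  qed
  define p where "p = map g [0..<?k]"
  have "p \<noteq> []" using two by (simp add: p_def)
  moreover have "distinct p"
  proof -
    have "i = j" if "i < ?k" "j < ?k" "g i = g j" for i j
    proof -
      have "a + int i = a + int j"
        using g(2)[OF that(1)] g(2)[OF that(2)] that(3) by metis
      then show ?thesis by simp
    qed
    then have "inj_on g {0..<?k}" by (intro inj_onI) simp
    then show ?thesis by (simp add: p_def distinct_map)
  qed
  moreover have "set p = ?S"
  proof -
    have "set p = g ` {..<?k}" by (simp add: p_def lessThan_atLeast0)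
    also have "\<dots> = ?S" using g(1) onto by blast
    finally show ?thesis .
  qed
  moreover have "\<not> p ! i \<rightarrow>\<^bsub>G\<^esub> p ! Suc i" if "Suc i < length p" for i
  proof -
    have "i < ?k" "Suc i < ?k" using that by (auto simp: p_def)
    then have "\<bar>f (p ! i) - f (p ! Suc i)\<bar> = 1"
      using g(2)[of i] g(2)[of "Suc i"] by (simp add: p_def)
    then show ?thesis using adj[of "p ! i" "p ! Suc i"] by auto
  qed
  ultimately show ?thesis
    unfolding hamiltonian_path_complement_induce_iff by blast
qed

lemma labeling_of_hamiltonian_path:
  assumes w: "w \<in> verts G" and dom: "\<And>v. v \<in> verts G \<Longrightarrow> v \<noteq> w \<Longrightarrow> w \<rightarrow>\<^bsub>G\<^esub> v"
    and p: "hamiltonian_path (graph_complement (G \<restriction> (verts G - {w}))) p"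
  shows "\<exists>f. L21_labeling G f \<and> labeling_span G f = int (card (verts G))"
proof -
  let ?S = "verts G - {w}" and ?n = "card (verts G)"
  have ne: "p \<noteq> []" and dist: "distinct p" and set: "set p = ?S"
    and nadj: "\<And>i. Suc i < length p \<Longrightarrow> \<not> p ! i \<rightarrow>\<^bsub>G\<^esub> p ! Suc i"
    using p[unfolded hamiltonian_path_complement_induce_iff] by blast+
  have "length p = card ?S"
    using distinct_card[OF dist] set by simp
  then have n: "?n = Suc (length p)"
    using card.remove[OF finite_verts w] by simp
  \<comment> \<open>The path gets labels up to \<open>?n - 2\<close>, so \<open>?n\<close> is the least label for \<open>w\<close> above them.\<close>
  have "\<exists>f. f w = int ?n \<and> (\<forall>i < length p. f (p ! i) = int i)"
  proof -
    define f where "f v = (if v = w then int ?n else int (THE i. i < length p \<and> p ! i = v))" for v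
    have "f (p ! i) = int i" if "i < length p" for i
    proof -
      have "p ! i \<noteq> w" using that set nth_mem by blast
      moreover have "(THE j. j < length p \<and> p ! j = p ! i) = i"
        using that dist by (auto simp: nth_eq_iff_index_eq)
      ultimately show ?thesis by (simp add: f_def)
    qed
    then show ?thesis by (intro exI[of _ f]) (simp add: f_def)
  qed
  then obtain f where fw: "f w = int ?n" and fp: "\<And>i. i < length p \<Longrightarrow> f (p ! i) = int i"
    by blast
  have vert: "v = w \<or> (\<exists>i < length p. v = p ! i)" if "v \<in> verts G" for v
    using that set by (metis DiffI in_set_conv_nth singletonD)
  have far: "2 \<le> f w - f v" if "v \<in> verts G" "v \<noteq> w" for v
    using vert[OF that(1)] that(2) fw fp n by auto
  have "inj_on f (verts G)"
  proof (rule inj_onI)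
    fix u v assume uv: "u \<in> verts G" "v \<in> verts G" "f u = f v"
    show "u = v"
    proof (rule ccontr)
      assume ne: "u \<noteq> v"
      have "u \<noteq> w" "v \<noteq> w" using far[of u] far[of v] uv ne by auto
      then obtain i j where "i < length p" "u = p ! i" "j < length p" "v = p ! j"
        using vert uv by blast
      then show False using fp uv(3) ne by auto
    qed
  qed
  moreover have "\<bar>f u - f v\<bar> \<ge> 2" if uv: "u \<rightarrow>\<^bsub>G\<^esub> v" for u v
  proof -
    have V: "u \<in> verts G" "v \<in> verts G" "u \<noteq> v"
      using adj_in_verts[OF uv] adj_not_same uv by auto
    show ?thesis
    proof (cases "u = w \<or> v = w")
      case True
      then show ?thesis using far[of u] far[of v] V by auto
    next
      case False
      then obtain i j where ij: "i < length p" "u = p ! i" "j < length p" "v = p ! j"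
        using vert V by blast
      have "i \<noteq> j" using V ij by auto
      moreover have "j \<noteq> Suc i" using nadj[of i] uv ij by auto
      moreover have "i \<noteq> Suc j"
        using nadj[of j] arcs_ends_symmetric[OF sym_arcs uv] ij by auto
      ultimately show ?thesis using fp ij by auto
    qed
  qed
  ultimately have "L21_labeling G f"
    using L21_labeling_iff_inj_on[OF dom] by simp
  moreover have "Max (f ` verts G) = int ?n"
  proof (rule Max_eqI)
    show "y \<le> int ?n" if "y \<in> f ` verts G" for y
      using that far fw by force
    show "int ?n \<in> f ` verts G" using fw w by (metis imageI)
  qed simp
  moreover have "Min (f ` verts G) = 0"
  proof (rule Min_eqI)
    show "0 \<le> y" if "y \<in> f ` verts G" for y
      using that vert fw fp by force
    have "f (p ! 0) = 0" "p ! 0 \<in> verts G"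
      using fp[of 0] ne set nth_mem[of 0 p] by auto
    then show "0 \<in> f ` verts G" by (metis imageI)
  qed simp
  ultimately show ?thesis
    by (auto simp: labeling_span_def)
qed

theorem lambda_number_dominating_vertex:
  assumes w: "w \<in> verts G" and dom: "\<And>v. v \<in> verts G \<Longrightarrow> v \<noteq> w \<Longrightarrow> w \<rightarrow>\<^bsub>G\<^esub> v"
    and two: "card (verts G) \<ge> 2"
  shows "card (verts G) \<le> lambda_number G"
    and "lambda_number G = card (verts G) \<longleftrightarrow>
      (\<exists>p. hamiltonian_path (graph_complement (G \<restriction> (verts G - {w}))) p)"
proof -
  have "verts G \<noteq> {}" using w by auto
  then obtain f where f: "L21_labeling G f" "labeling_span G f = int (lambda_number G)"
    by (rule lambda_number_attained)
  show le: "card (verts G) \<le> lambda_number G"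
    using card_le_labeling_span[OF w dom two f(1)] f(2) by simp
  show "lambda_number G = card (verts G) \<longleftrightarrow>
      (\<exists>p. hamiltonian_path (graph_complement (G \<restriction> (verts G - {w}))) p)" (is "?L \<longleftrightarrow> ?R")
  proof
    assume ?L
    then show ?R
      using hamiltonian_path_of_labeling[OF w dom two f(1)] f(2) by simp
  next
    assume ?R
    then obtain h where "L21_labeling G h" "labeling_span G h = int (card (verts G))"
      using labeling_of_hamiltonian_path[OF w dom] by blast
    then show ?L
      using lambda_number_le le by (blast intro: antisym)
  qed
qed

end

section \<open>The enhanced power graph\<close>

lemma one_dominates_enhanced_power_graph:
  assumes "group G" and "x \<in> carrier G" and "x \<noteq> \<one>\<^bsub>G\<^esub>"
  shows "\<one>\<^bsub>G\<^esub> \<rightarrow>\<^bsub>enhanced_power_graph G\<^esub> x"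
proof -
  interpret group G by fact
  have "\<one>\<^bsub>G\<^esub> \<in> generate G {x}" "x \<in> generate G {x}"
    by (auto intro: generate.one generate.incl)
  then show ?thesis
    using assms(2,3) by (auto simp: enhanced_power_graph_def arcs_ends_conv)
qed

theorem theorem3p1:
  fixes G :: "('a, 'm) monoid_scheme"
  assumes "group G" and "finite (carrier G)" and "order G \<ge> 2"
  shows "lambda_number (enhanced_power_graph G) \<ge> order G \<and>
    (lambda_number (enhanced_power_graph G) = order G \<longleftrightarrow>
      (\<exists>p. hamiltonian_path
             (graph_complement (enhanced_power_graph G \<restriction> (carrier G - {\<one>\<^bsub>G\<^esub>}))) p))"
proof -
  interpret E: graph "enhanced_power_graph G"
    by (rule graph_enhanced_power_graph) fact
  have V: "verts (enhanced_power_graph G) = carrier G"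
    by (simp add: enhanced_power_graph_def)
  have one: "\<one>\<^bsub>G\<^esub> \<in> carrier G"
    using assms(1) by (simp add: group.is_monoid)
  show ?thesis
    using E.lambda_number_dominating_vertex[of "\<one>\<^bsub>G\<^esub>"] one assms(3)
      one_dominates_enhanced_power_graph[OF assms(1)]
    by (simp add: V order_def)
qed

end
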